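(* The class of epiRegular groups contains: (1) all Baumslag–Solitar groups $BS(m,n)$; (2) all automatic groups; and (3) all autostackable groups.
   Context: epiRegular groups. For a set $X$, $X^*$ denotes the set of all finite strings over $X$, including the empty string $\varepsilon$. For a group $G$ and $X\subseteq G$, and $w\in X^*$, $g\in G$, write $w=_G g$ if the product in $G$ of the letters of $w$ equals $g$. A group $G$ is epiRegular if there are a finite set $X\subseteq G$ generating $G$ as a monoid and a regular language $L\subseteq X^*$ such that no $w\in L$ satisfies $w=_G 1_G$, and for every $h\in G\setminus\{1_G\}$ there is $w_h\in L$ with $w_h=_G h$. $BS(m,n)=\langle a,t\mid t^{-1}a^mt=a^n\rangle$ with $m,n$ nonzero integers. Automatic groups are meant in the standard sense. Autostackable groups. Let $G$ be a finitely generated group with a finite inverse-closed generating set $X$. The Cayley graph $\Gamma(G,X)$ is the directed graph with vertex set $G$ and, for each $g\in G$, $a\in X$, a directed edge $e_{g,a}$ from $g$ to $ga$ labelled $a$; let $\vec E$ be its edge set. A set of normal forms for $G$ over $X$ is a set $N\subseteq X^*$ such that each $g\in G$ is represented by a unique string $y_g\in N$. Given $N$, the edge $e_{g,a}$ is degenerate if there is an equality of strings $y_ga=y_{ga}$ or $y_g=y_{ga}a^{-1}$; $\vec E_{d}$ is the set of degenerate edges, and $\vec E_{r}=\vec E\setminus\vec E_{d}$ is the set of recursive edges. Let $\#\notin X$ be a padding symbol, $\widehat X=X\cup\{\#\}$ and $\overline X=\widehat X^3\setminus\{(\#,\#,\#)\}$. For $u,v,w\in X^*$, $(u,v,w)^t\in\overline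 X^*$ is the string obtained by padding $u,v,w$ on the right with $\#$ to the common length $\max(|u|,|v|,|w|)$ and reading the resulting three strings in parallel, letter by letter. A set $L\subseteq (X^* )^3$ is synchronously regular if $\{(u,v,w)^t\mid (u,v,w)\in L\}$ is a regular language over $\overline X$. $G$ is autostackable if for some finite inverse-closed generating set $X$ there are a set $N$ of normal forms for $G$ over $X$ containing $\varepsilon$, a constant $k$, and a function $\phi:N\times X\to X^*$ such that: (1) $\mathrm{graph}(\phi)=\{(y_g,x,\phi(y_g,x))\mid g\in G,x\in X\}$ is synchronously regular; (2) for each $g\in G$, $x\in X$, the word $\phi(y_g,x)$ has length at most $k$ and represents the element $x$ of $G$, and: (2d) if $e_{g,x}\in\vec E_d$ then $\phi(y_g,x)=x$ as words; (2r) the transitive closure of the relation $<$ on $\vec E_r$, defined by $e'<e_{g,x}$ whenever $e',e_{g,x}\in\vec E_r$ and $e'$ lies on the directed path in $\Gamma(G,X)$ labelled $\phi(y_g,x)$ starting at the vertex $g$, is a strict well-founded partial ordering. *)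

theory Defs
  imports "HOL-Algebra.Generated_Groups"
begin

section \<open>Regular languages\<close>

text \<open>Acceptance by a complete deterministic finite automaton over the alphabet \<open>S\<close>. As state
  sets are finite, taking natural numbers as states is no restriction.\<close>

definition regular_language :: "'x set \<Rightarrow> 'x list set \<Rightarrow> bool" where
  "regular_language S L \<longleftrightarrow> finite S \<and>
     (\<exists>(Q :: nat set) q0 F \<delta>. finite Q \<and> q0 \<in> Q \<and> F \<subseteq> Q \<and>
        (\<forall>q\<in>Q. \<forall>x\<in>S. \<delta> q x \<in> Q) \<and>
        L = {w \<in> lists S. foldl \<delta> q0 w \<in> F})"

text \<open>The padding symbol is \<^const>\<open>None\<close>; a letter \<open>x\<close> of the original alphabet becomes
  \<open>Some x\<close>.\<close>

definition padded_nth :: "'x list \<Rightarrow> nat \<Rightarrow> 'x option" where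
  "padded_nth u i = (if i < length u then Some (u ! i) else None)"

definition pad2 :: "'x list \<times> 'x list \<Rightarrow> ('x option \<times> 'x option) list" where
  "pad2 = (\<lambda>(u, v). map (\<lambda>i. (padded_nth u i, padded_nth v i))
     [0..<max (length u) (length v)])"

definition pad3 :: "'x list \<times> 'x list \<times> 'x list \<Rightarrow> ('x option \<times> 'x option \<times> 'x option) list" where
  "pad3 = (\<lambda>(u, v, w). map (\<lambda>i. (padded_nth u i, padded_nth v i, padded_nth w i))
     [0..<max (length u) (max (length v) (length w))])"

definition padded_alphabet :: "'x set \<Rightarrow> 'x option set" where
  "padded_alphabet S = insert None (Some ` S)"

definition sync_regular2 :: "'x set \<Rightarrow> ('x list \<times> 'x list) set \<Rightarrow> bool" where
  "sync_regular2 S R \<longleftrightarrow> R \<subseteq> lists S \<times> lists S \<and>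
     regular_language (padded_alphabet S \<times> padded_alphabet S - {(None, None)}) (pad2 ` R)"

definition sync_regular3 :: "'x set \<Rightarrow> ('x list \<times> 'x list \<times> 'x list) set \<Rightarrow> bool" where
  "sync_regular3 S R \<longleftrightarrow> R \<subseteq> lists S \<times> lists S \<times> lists S \<and>
     regular_language
       (padded_alphabet S \<times> padded_alphabet S \<times> padded_alphabet S - {(None, None, None)})
       (pad3 ` R)"


section \<open>Words in groups\<close>

definition word_value :: "('a, 'b) monoid_scheme \<Rightarrow> 'a list \<Rightarrow> 'a" where
  "word_value G w = foldr (\<otimes>\<^bsub>G\<^esub>) w \<one>\<^bsub>G\<^esub>"

definition generates_as_monoid :: "('a, 'b) monoid_scheme \<Rightarrow> 'a set \<Rightarrow> bool" where
  "generates_as_monoid G X \<longleftrightarrow> X \<subseteq> carrier G \<and> word_value G ` lists X = carrier G"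


section \<open>EpiRegular groups\<close>

definition epiRegular :: "('a, 'b) monoid_scheme \<Rightarrow> bool" where
  "epiRegular G \<longleftrightarrow> group G \<and>
     (\<exists>X L. finite X \<and> generates_as_monoid G X \<and> regular_language X L \<and>
        (\<forall>w\<in>L. word_value G w \<noteq> \<one>\<^bsub>G\<^esub>) \<and>
        (\<forall>h \<in> carrier G - {\<one>\<^bsub>G\<^esub>}. \<exists>w\<in>L. word_value G w = h))"


section \<open>Automatic groups\<close>

text \<open>The definition of Epstein et al.: \<open>A\<close> is an abstract finite alphabet, mapped by \<open>p\<close> (not
  necessarily injectively) to a set of monoid generators; taking \<open>A\<close> to consist of natural
  numbers is no restriction. \<open>L\<close> is the language of the word acceptor. The two regularity
  conditions express the existence of the equality recogniser and of the multiplier automata.\<close>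

definition automatic_group :: "('a, 'b) monoid_scheme \<Rightarrow> bool" where
  "automatic_group G \<longleftrightarrow> group G \<and>
     (\<exists>(A :: nat set) (p :: nat \<Rightarrow> 'a) L.
        finite A \<and> generates_as_monoid G (p ` A) \<and> regular_language A L \<and>
        (\<forall>g \<in> carrier G. \<exists>w\<in>L. word_value G (map p w) = g) \<and>
        sync_regular2 A {(u, v). u \<in> L \<and> v \<in> L \<and>
          word_value G (map p u) = word_value G (map p v)} \<and>
        (\<forall>x\<in>A. sync_regular2 A {(u, v). u \<in> L \<and> v \<in> L \<and>
          word_value G (map p u) \<otimes>\<^bsub>G\<^esub> p x = word_value G (map p v)}))"


section \<open>Autostackable groups\<close>

definition normal_forms :: "('a, 'b) monoid_scheme \<Rightarrow> 'a set \<Rightarrow> 'a list set \<Rightarrow> bool" where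
  "normal_forms G X N \<longleftrightarrow> N \<subseteq> lists X \<and> (\<forall>g \<in> carrier G. \<exists>!y. y \<in> N \<and> word_value G y = g)"

definition nf :: "('a, 'b) monoid_scheme \<Rightarrow> 'a list set \<Rightarrow> 'a \<Rightarrow> 'a list" where
  "nf G N g = (THE y. y \<in> N \<and> word_value G y = g)"

text \<open>The Cayley graph edge from \<open>g\<close> to \<open>g a\<close> labelled \<open>a\<close> is represented by the pair \<open>(g, a)\<close>.\<close>

definition cayley_edges :: "('a, 'b) monoid_scheme \<Rightarrow> 'a set \<Rightarrow> ('a \<times> 'a) set" where
  "cayley_edges G X = carrier G \<times> X"

definition degenerate_edges ::
  "('a, 'b) monoid_scheme \<Rightarrow> 'a set \<Rightarrow> 'a list set \<Rightarrow> ('a \<times> 'a) set" where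
  "degenerate_edges G X N = {(g, a) \<in> cayley_edges G X.
     nf G N g @ [a] = nf G N (g \<otimes>\<^bsub>G\<^esub> a) \<or>
     nf G N g = nf G N (g \<otimes>\<^bsub>G\<^esub> a) @ [inv\<^bsub>G\<^esub> a]}"

definition recursive_edges ::
  "('a, 'b) monoid_scheme \<Rightarrow> 'a set \<Rightarrow> 'a list set \<Rightarrow> ('a \<times> 'a) set" where
  "recursive_edges G X N = cayley_edges G X - degenerate_edges G X N"

definition path_edges :: "('a, 'b) monoid_scheme \<Rightarrow> 'a \<Rightarrow> 'a list \<Rightarrow> ('a \<times> 'a) set" where
  "path_edges G g w = {(g \<otimes>\<^bsub>G\<^esub> word_value G (take i w), w ! i) | i. i < length w}"

definition stacking_order ::
  "('a, 'b) monoid_scheme \<Rightarrow> 'a set \<Rightarrow> 'a list set \<Rightarrow> ('a list \<Rightarrow> 'a \<Rightarrow> 'a list) \<Rightarrow>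
    (('a \<times> 'a) \<times> ('a \<times> 'a)) set" where
  "stacking_order G X N \<phi> =
     {(e', (g, x)) | e' g x. e' \<in> recursive_edges G X N \<and> (g, x) \<in> recursive_edges G X N \<and>
        e' \<in> path_edges G g (\<phi> (nf G N g) x)}"

text \<open>\<open>\<phi>\<close> is only relevant on \<open>N \<times> X\<close>. A transitive closure is transitive by construction and
  well-foundedness implies irreflexivity, so \<open>wf\<close> says that it is a strict well-founded partial
  ordering.\<close>

definition autostackable :: "('a, 'b) monoid_scheme \<Rightarrow> bool" where
  "autostackable G \<longleftrightarrow> group G \<and>
     (\<exists>X N (k :: nat) \<phi>.
        finite X \<and> X \<subseteq> carrier G \<and> (\<forall>x\<in>X. inv\<^bsub>G\<^esub> x \<in> X) \<and> generate G X = carrier G \<and>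
        normal_forms G X N \<and> [] \<in> N \<and>
        (\<forall>y\<in>N. \<forall>x\<in>X. \<phi> y x \<in> lists X) \<and>
        sync_regular3 X {(nf G N g, [x], \<phi> (nf G N g) x) | g x. g \<in> carrier G \<and> x \<in> X} \<and>
        (\<forall>g \<in> carrier G. \<forall>x\<in>X.
           length (\<phi> (nf G N g) x) \<le> k \<and>
           word_value G (\<phi> (nf G N g) x) = x \<and>
           ((g, x) \<in> degenerate_edges G X N \<longrightarrow> \<phi> (nf G N g) x = [x])) \<and>
        wf ((stacking_order G X N \<phi>)\<^sup>+))"


section \<open>Presented groups and Baumslag-Solitar groups\<close>

text \<open>The letter \<open>(x, True)\<close> stands for the generator \<open>x\<close> and \<open>(x, False)\<close> for its formal
  inverse. A pair \<open>(u, v)\<close> in \<open>R\<close> is the defining relation \<open>u = v\<close>; \<open>pres_eq R\<close> is the congruence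
  on the free monoid over these letters generated by free cancellation and \<open>R\<close>.\<close>

type_synonym 'x gword = "('x \<times> bool) list"

inductive pres_eq :: "('x gword \<times> 'x gword) set \<Rightarrow> 'x gword \<Rightarrow> 'x gword \<Rightarrow> bool"
  for R where
  rel: "(u, v) \<in> R \<Longrightarrow> pres_eq R u v"
| cancel: "pres_eq R [(x, b), (x, \<not> b)] []"
| refl: "pres_eq R u u"
| sym: "pres_eq R u v \<Longrightarrow> pres_eq R v u"
| trans: "pres_eq R u v \<Longrightarrow> pres_eq R v w \<Longrightarrow> pres_eq R u w"
| append: "pres_eq R u u' \<Longrightarrow> pres_eq R v v' \<Longrightarrow> pres_eq R (u @ v) (u' @ v')"

definition pres_rel :: "('x gword \<times> 'x gword) set \<Rightarrow> ('x gword \<times> 'x gword) set" where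
  "pres_rel R = {(u, v). pres_eq R u v}"

definition presented_group :: "('x gword \<times> 'x gword) set \<Rightarrow> 'x gword set monoid" where
  "presented_group R =
     \<lparr>carrier = UNIV // pres_rel R,
      mult = (\<lambda>U V. \<Union>u\<in>U. \<Union>v\<in>V. pres_rel R `` {u @ v}),
      one = pres_rel R `` {[]}\<rparr>"

lemma equiv_pres_rel: "equiv UNIV (pres_rel R)"
  by (rule equivI)
    (auto simp: pres_rel_def refl_on_def sym_def trans_def
      intro: pres_eq.refl pres_eq.sym pres_eq.trans)

lemma presented_group_mult_class:
  "pres_rel R `` {u} \<otimes>\<^bsub>presented_group R\<^esub> pres_rel R `` {v} = pres_rel R `` {u @ v}"
proof -
  have "(\<lambda>u v. pres_rel R `` {u @ v}) respects2 pres_rel R"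
    by (rule congruent2I')
      (auto simp: pres_rel_def intro: pres_eq.append pres_eq.sym pres_eq.trans)
  then show ?thesis
    using UN_equiv_class2[OF equiv_pres_rel equiv_pres_rel]
    by (fastforce simp: presented_group_def)
qed

lemma presented_group_inverse_word:
  "pres_eq R (rev (map (\<lambda>(x, b). (x, \<not> b)) u) @ u) []"
proof (induction u)
  case Nil
  show ?case by (simp add: pres_eq.refl)
next
  case (Cons a u)
  obtain x b where a: "a = (x, b)" by fastforce
  let ?v = "rev (map (\<lambda>(x, b). (x, \<not> b)) u)"
  have "pres_eq R ([(x, \<not> b), (x, b)] @ u) ([] @ u)"
    using pres_eq.append[OF pres_eq.cancel[of R x "\<not> b"] pres_eq.refl] by simp
  then have "pres_eq R (?v @ [(x, \<not> b), (x, b)] @ u) (?v @ u)"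
    using pres_eq.append[OF pres_eq.refl] by fastforce
  then show ?case
    using Cons.IH pres_eq.trans by (fastforce simp: a)
qed

lemma group_presented_group: "group (presented_group R)"
proof (rule groupI)
  note mult = presented_group_mult_class
  have car: "U \<in> carrier (presented_group R) \<longleftrightarrow> (\<exists>u. U = pres_rel R `` {u})" for U
    by (auto simp: presented_group_def quotient_def)
  have one: "\<one>\<^bsub>presented_group R\<^esub> = pres_rel R `` {[]}"
    by (simp add: presented_group_def)
  show "\<one>\<^bsub>presented_group R\<^esub> \<in> carrier (presented_group R)"
    using car one by blast
  show "U \<otimes>\<^bsub>presented_group R\<^esub> V \<in> carrier (presented_group R)"
    if "U \<in> carrier (presented_group R)" "V \<in> carrier (presented_group R)" for U V
    using that car mult by metis
  show "U \<otimes>\<^bsub>presented_group R\<^esub> V \<otimes>\<^bsub>presented_group R\<^esub> W =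
      U \<otimes>\<^bsub>presented_group R\<^esub> (V \<otimes>\<^bsub>presented_group R\<^esub> W)"
    if "U \<in> carrier (presented_group R)" "V \<in> carrier (presented_group R)"
      "W \<in> carrier (presented_group R)" for U V W
    using that car mult by (metis append_assoc)
  show "\<one>\<^bsub>presented_group R\<^esub> \<otimes>\<^bsub>presented_group R\<^esub> U = U"
    if "U \<in> carrier (presented_group R)" for U
    using that car mult one by (metis append_Nil)
  show "\<exists>V\<in>carrier (presented_group R).
      V \<otimes>\<^bsub>presented_group R\<^esub> U = \<one>\<^bsub>presented_group R\<^esub>"
    if "U \<in> carrier (presented_group R)" for U
  proof -
    obtain u where u: "U = pres_rel R `` {u}" using \<open>U \<in> _\<close> car by blast
    let ?V = "pres_rel R `` {rev (map (\<lambda>(x, b). (x, \<not> b)) u)}"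
    have "?V \<otimes>\<^bsub>presented_group R\<^esub> U = \<one>\<^bsub>presented_group R\<^esub>"
      unfolding u mult one using presented_group_inverse_word[of R u]
      by (intro equiv_class_eq[OF equiv_pres_rel]) (simp add: pres_rel_def)
    then show ?thesis using car by blast
  qed
qed

datatype bs_gen = BS_a | BS_t

definition gen_power :: "'x \<Rightarrow> int \<Rightarrow> 'x gword" where
  "gen_power x m = replicate (nat \<bar>m\<bar>) (x, m \<ge> 0)"

definition baumslag_solitar :: "int \<Rightarrow> int \<Rightarrow> bs_gen gword set monoid" where
  "baumslag_solitar m n = presented_group
     {(gen_power BS_t (-1) @ gen_power BS_a m @ gen_power BS_t 1, gen_power BS_a n)}"

lemma group_baumslag_solitar: "group (baumslag_solitar m n)"
  unfolding baumslag_solitar_def by (rule group_presented_group)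

end

theory Submission
  imports Defs
begin

text \<open>A group is epiRegular as soon as it has a regular set of representing words from which the words
  for the identity can be removed without losing regularity.  In each of the three classes there is
  a natural candidate, and the point is why the removal is possible.

  For an autostackable group, the candidate is the set of normal forms.  It is a projection of the
  synchronously regular graph of the stacking map, hence regular, and the only word in it that
  represents the identity is the empty word (\<open>autostackable_imp_epiRegular\<close>).

  In the language of an automatic group the identity may have many representatives.  They are the
  words that the equality recogniser relates to one chosen representative, and the section of a
  synchronously regular relation over a fixed word is regular (\<open>automatic_imp_epiRegular\<close>).

  A Baumslag-Solitar group is an HNN extension of the infinite cyclic group, and the candidate is the
  set of its normal forms \<open>a\<^sup>i t\<^sup>e a\<^sup>j t\<^sup>f \<dots> a\<^sup>k\<close>, in which the power of \<open>a\<close> in front of each letter \<open>t\<close>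
  or its inverse is a remainder modulo one of the two exponents, only the last power is
  unrestricted, and no letter \<open>t\<close> is adjacent to its inverse.  Only finitely many powers of \<open>a\<close> need to be told apart, so these words form a
  regular language, however long they may be compared with other words for the same element.  That
  the empty word is the only one among them that represents the identity is the uniqueness of normal
  forms.  It follows from van der Waerden's argument: the group acts on the normal forms, and the word
  of a normal form \<open>x\<close> sends the empty normal form to \<open>x\<close>
  (\<open>act_pres_eq\<close>, \<open>act_nform_word\<close>, \<open>epiRegular_BS\<close>).\<close>

section \<open>Regular languages\<close>

text \<open>The states may come from any type: a finite set of them can be numbered.  The acceptance
  condition is a predicate, so that the accepting states need not be singled out among \<open>Q\<close>.\<close>

lemma regular_languageI:
  fixes Q :: "'q set"
  assumes "finite S" "finite Q" "s \<in> Q" and closed: "\<And>q x. q \<in> Q \<Longrightarrow> x \<in> S \<Longrightarrow> \<delta> q x \<in> Q"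
    and L: "\<And>w. w \<in> L \<longleftrightarrow> w \<in> lists S \<and> P (foldl \<delta> s w)"
  shows "regular_language S L"
proof -
  obtain f :: "'q \<Rightarrow> nat" where f: "inj_on f Q"
    using finite_imp_inj_to_nat_seg[OF \<open>finite Q\<close>] by blast
  define \<delta>' where "\<delta>' k x = f (\<delta> (inv_into Q f k) x)" for k x
  have run: "foldl \<delta>' (f q) w = f (foldl \<delta> q w) \<and> foldl \<delta> q w \<in> Q"
    if "q \<in> Q" "w \<in> lists S" for q w
    using that by (induction w arbitrary: q) (auto simp: \<delta>'_def f closed)
  have "foldl \<delta>' (f s) w \<in> f ` {q \<in> Q. P q} \<longleftrightarrow> P (foldl \<delta> s w)" if "w \<in> lists S" for w
    using run[OF \<open>s \<in> Q\<close> that] inj_on_image_mem_iff[OF f, of "foldl \<delta> s w" "{q \<in> Q. P q}"] by auto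
  then have "L = {w \<in> lists S. foldl \<delta>' (f s) w \<in> f ` {q \<in> Q. P q}}"
    using L by blast
  moreover have "\<forall>k\<in>f ` Q. \<forall>x\<in>S. \<delta>' k x \<in> f ` Q"
    using f by (auto simp: \<delta>'_def closed)
  ultimately show ?thesis
    unfolding regular_language_def using assms(1-3)
    by (intro conjI exI[of _ "f ` Q"] exI[of _ "f s"] exI[of _ "f ` {q \<in> Q. P q}"] exI[of _ \<delta>'])
      auto
qed

lemma regular_languageE:
  assumes "regular_language S L"
  obtains Q :: "nat set" and q0 \<delta> F where "finite S" "finite Q" "q0 \<in> Q"
    "\<And>q x. q \<in> Q \<Longrightarrow> x \<in> S \<Longrightarrow> \<delta> q x \<in> Q"
    "\<And>w. w \<in> L \<longleftrightarrow> w \<in> lists S \<and> foldl \<delta> q0 w \<in> F"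
  using assms unfolding regular_language_def by (elim conjE exE) (rule that, auto)

lemma regular_language_subset: "regular_language S L \<Longrightarrow> L \<subseteq> lists S"
  by (auto simp: regular_language_def)

lemma regular_language_empty: "finite S \<Longrightarrow> regular_language S {}"
  by (rule regular_languageI[where Q = "{()}" and \<delta> = "\<lambda>_ _. ()" and P = "\<lambda>_. False"]) auto

lemma regular_language_diff:
  assumes "regular_language S K" "regular_language S L"
  shows "regular_language S (K - L)"
proof -
  obtain Q1 :: "nat set" and q1 \<delta>1 F1 where 1: "finite S" "finite Q1" "q1 \<in> Q1"
    "\<And>q x. q \<in> Q1 \<Longrightarrow> x \<in> S \<Longrightarrow> \<delta>1 q x \<in> Q1"
    "\<And>w. w \<in> K \<longleftrightarrow> w \<in> lists S \<and> foldl \<delta>1 q1 w \<in> F1"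
    by (rule regular_languageE[OF assms(1)]) (rule that)
  obtain Q2 :: "nat set" and q2 \<delta>2 F2 where 2: "finite Q2" "q2 \<in> Q2"
    "\<And>q x. q \<in> Q2 \<Longrightarrow> x \<in> S \<Longrightarrow> \<delta>2 q x \<in> Q2"
    "\<And>w. w \<in> L \<longleftrightarrow> w \<in> lists S \<and> foldl \<delta>2 q2 w \<in> F2"
    by (rule regular_languageE[OF assms(2)]) (rule that)
  let ?\<delta> = "\<lambda>(p, q) x. (\<delta>1 p x, \<delta>2 q x)"
  have run: "foldl ?\<delta> (p, q) w = (foldl \<delta>1 p w, foldl \<delta>2 q w)" for p q w
    by (induction w arbitrary: p q) auto
  show ?thesis
    by (rule regular_languageI[where Q = "Q1 \<times> Q2" and s = "(q1, q2)" and \<delta> = ?\<delta>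
          and P = "\<lambda>(p, q). p \<in> F1 \<and> q \<notin> F2"])
      (auto simp: 1 2 run simp del: in_lists_conv_set)
qed

lemma regular_language_remove_Nil:
  assumes "regular_language S L"
  shows "regular_language S (L - {[]})"
proof -
  have "finite S" using assms by (simp add: regular_language_def)
  have run: "foldl (\<lambda>_ _. False) b w \<longleftrightarrow> b \<and> w = []" for b and w :: "'a list"
    by (induction w arbitrary: b) auto
  have "regular_language S {[]}"
    by (rule regular_languageI[where Q = UNIV and s = True and \<delta> = "\<lambda>_ _. False" and P = "\<lambda>b. b"])
      (use \<open>finite S\<close> in \<open>auto simp: run\<close>)
  with assms show ?thesis by (rule regular_language_diff)
qed

text \<open>The subset construction: a deterministic automaton for the image tracks the states that the
  given automaton reaches on the preimages of the word read so far.\<close>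

lemma regular_language_map_image:
  assumes "regular_language A L"
  shows "regular_language (p ` A) (map p ` L)"
proof -
  obtain Q :: "nat set" and q0 \<delta> F where Q: "finite A" "finite Q" "q0 \<in> Q"
    "\<And>q x. q \<in> Q \<Longrightarrow> x \<in> A \<Longrightarrow> \<delta> q x \<in> Q"
    "\<And>w. w \<in> L \<longleftrightarrow> w \<in> lists A \<and> foldl \<delta> q0 w \<in> F"
    by (rule regular_languageE[OF assms]) (rule that)
  define \<Delta> where "\<Delta> T y = {\<delta> q x | q x. q \<in> T \<and> x \<in> A \<and> p x = y}" for T y
  have run: "foldl \<Delta> T v = {foldl \<delta> q w | q w. q \<in> T \<and> w \<in> lists A \<and> map p w = v}" for T v
  proof (induction v arbitrary: T)
    case Nil
    show ?case by auto
  next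
    case (Cons y v)
    have "foldl \<Delta> T (y # v) =
        {foldl \<delta> (\<delta> q x) w | q x w. q \<in> T \<and> x \<in> A \<and> p x = y \<and> w \<in> lists A \<and> map p w = v}"
      by (auto simp: Cons.IH \<Delta>_def)
    also have "\<dots> = {foldl \<delta> q w | q w. q \<in> T \<and> w \<in> lists A \<and> map p w = y # v}"
      (is "?l = ?r")
    proof
      show "?l \<subseteq> ?r"
      proof
        fix r assume "r \<in> ?l"
        then obtain q x w where "r = foldl \<delta> q (x # w)" "q \<in> T" "x # w \<in> lists A"
          "map p (x # w) = y # v" by auto
        then show "r \<in> ?r" by (simp only: mem_Collect_eq) metis
      qed
      show "?r \<subseteq> ?l"
      proof
        fix r assume "r \<in> ?r"
        then obtain q w where qw: "r = foldl \<delta> q w" "q \<in> T" "w \<in> lists A" "map p w = y # v"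
          by (elim CollectE exE conjE) (rule that)
        then obtain x w' where "w = x # w'" "p x = y" "map p w' = v" by auto
        with qw have "r = foldl \<delta> (\<delta> q x) w' \<and> q \<in> T \<and> x \<in> A \<and> p x = y \<and> w' \<in> lists A \<and> map p w' = v"
          by simp
        then show "r \<in> ?l" by (simp only: mem_Collect_eq) metis
      qed
    qed
    finally show ?case .
  qed
  show ?thesis
  proof (rule regular_languageI[where Q = "Pow Q" and s = "{q0}" and \<delta> = \<Delta>
        and P = "\<lambda>T. T \<inter> F \<noteq> {}"])
    show "v \<in> map p ` L \<longleftrightarrow> v \<in> lists (p ` A) \<and> foldl \<Delta> {q0} v \<inter> F \<noteq> {}" for v
    proof -
      have "foldl \<Delta> {q0} v \<inter> F \<noteq> {} \<longleftrightarrow> (\<exists>w\<in>L. map p w = v)"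
        unfolding run Bex_def Q(5) by (auto simp del: in_lists_conv_set)
      moreover have "map p w \<in> lists (p ` A)" if "w \<in> L" for w
        using that by (auto simp: Q(5))
      ultimately show ?thesis by blast
    qed
  qed (use Q in \<open>auto simp: \<Delta>_def\<close>)
qed


section \<open>Synchronously regular relations\<close>

lemma map_padded_nth:
  "length u \<le> k \<Longrightarrow> map (padded_nth u) [0..<k] = map Some u @ replicate (k - length u) None"
  by (rule nth_equalityI) (auto simp: padded_nth_def nth_append)

text \<open>Padded words can be decoded, since padding symbols are not letters.  Therefore an automaton that
  reads padded tuples recognises the tuples themselves.\<close>

lemma padding_cancel:
  assumes "map Some u @ replicate i None = map Some v @ replicate j None"
  shows "u = v"
proof -
  have "map the (filter (\<lambda>x. x \<noteq> None) (map Some u @ replicate i None)) = u" for u :: "'a list" and i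
    by (simp add: filter_map o_def)
  with assms show ?thesis by metis
qed

lemma map_fst_pad2: "\<exists>i. map fst (pad2 (u, v)) = map Some u @ replicate i None"
  using map_padded_nth[of u "max (length u) (length v)"] by (auto simp: pad2_def o_def)

lemma map_snd_pad2: "\<exists>i. map snd (pad2 (u, v)) = map Some v @ replicate i None"
  using map_padded_nth[of v "max (length u) (length v)"] by (auto simp: pad2_def o_def)

lemma map_fst_pad3: "\<exists>i. map fst (pad3 (u, v, w)) = map Some u @ replicate i None"
  using map_padded_nth[of u "max (length u) (max (length v) (length w))"]
  by (auto simp: pad3_def o_def)

lemma inj_pad2: "inj pad2"
proof (rule injI)
  fix x y :: "'a list \<times> 'a list"
  assume eq: "pad2 x = pad2 y"
  obtain u v u' v' where xy: "x = (u, v)" "y = (u', v')" by fastforce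
  have "u = u'" using map_fst_pad2[of u v] map_fst_pad2[of u' v'] eq
    by (auto simp: xy dest: padding_cancel)
  moreover have "v = v'" using map_snd_pad2[of u v] map_snd_pad2[of u' v'] eq
    by (auto simp: xy dest: padding_cancel)
  ultimately show "x = y" using xy by simp
qed

lemma pad2_Nil_right: "pad2 (u, []) = map (\<lambda>x. (Some x, None)) u"
  by (rule nth_equalityI) (auto simp: pad2_def padded_nth_def)

lemma pad2_Nil_Cons: "pad2 ([], y # v) = (None, Some y) # pad2 ([], v)"
  by (simp add: pad2_def padded_nth_def map_upt_Suc del: upt_Suc)

lemma pad2_Cons_Cons: "pad2 (x # u, y # v) = (Some x, Some y) # pad2 (u, v)"
  by (simp add: pad2_def padded_nth_def map_upt_Suc del: upt_Suc)

text \<open>An automaton for the section of a relation over a fixed word \<open>u\<close> remembers, next to a state of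
  the automaton for the relation, the part of \<open>u\<close> that has not been consumed.  What is left of
  \<open>u\<close> when the input ends is fed to the latter automaton in the acceptance condition.\<close>

lemma sync_regular2_section:
  assumes "sync_regular2 A R"
  shows "regular_language A {v. (u, v) \<in> R}"
proof -
  let ?\<Sigma> = "padded_alphabet A \<times> padded_alphabet A - {(None, None)}"
  have "(\<lambda>x. (None, Some x)) ` A \<subseteq> ?\<Sigma>" by (auto simp: padded_alphabet_def)
  moreover have "finite ?\<Sigma>"
    using assms by (simp add: sync_regular2_def regular_language_def)
  ultimately have "finite ((\<lambda>x. (None :: 'a option, Some x)) ` A)" by (rule finite_subset)
  then have "finite A" by (rule finite_imageD) (simp add: inj_on_def)
  have R: "R \<subseteq> lists A \<times> lists A" and reg: "regular_language ?\<Sigma> (pad2 ` R)"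
    using assms by (auto simp: sync_regular2_def)
  obtain Q :: "nat set" and q0 \<delta> F where Q: "finite ?\<Sigma>" "finite Q" "q0 \<in> Q"
    "\<And>q x. q \<in> Q \<Longrightarrow> x \<in> ?\<Sigma> \<Longrightarrow> \<delta> q x \<in> Q"
    "\<And>w. w \<in> pad2 ` R \<longleftrightarrow> w \<in> lists ?\<Sigma> \<and> foldl \<delta> q0 w \<in> F"
    by (rule regular_languageE[OF reg]) (rule that)
  show ?thesis
  proof (cases "u \<in> lists A")
    case False
    then have "{v. (u, v) \<in> R} = {}" using R by blast
    then show ?thesis using regular_language_empty[OF \<open>finite A\<close>] by simp
  next
    case True
    define step where "step = (\<lambda>(q, r) y. case r of [] \<Rightarrow> (\<delta> q (None, Some y), [])
      | x # r' \<Rightarrow> (\<delta> q (Some x, Some y), r'))"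
    define finish where "finish = (\<lambda>(q, r). foldl \<delta> q (map (\<lambda>x. (Some x, None)) r))"
    have run: "finish (foldl step (q, r) v) = foldl \<delta> q (pad2 (r, v))" for q r v
      by (induction v arbitrary: q r)
        (auto simp: finish_def step_def pad2_Nil_right pad2_Nil_Cons pad2_Cons_Cons split: list.split)
    have alphabet: "pad2 (u, v) \<in> lists ?\<Sigma>" if "v \<in> lists A" for v
      using that True
      by (auto simp: pad2_def padded_nth_def padded_alphabet_def less_max_iff_disj split: if_splits)
    show ?thesis
    proof (rule regular_languageI[where Q = "Q \<times> (\<lambda>i. drop i u) ` {..length u}" and s = "(q0, u)"
          and \<delta> = step and P = "\<lambda>s. finish s \<in> F"])
      show "step s y \<in> Q \<times> (\<lambda>i. drop i u) ` {..length u}"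
        if s: "s \<in> Q \<times> (\<lambda>i. drop i u) ` {..length u}" and "y \<in> A" for s y
      proof -
        obtain q i where qi: "s = (q, drop i u)" "q \<in> Q" "i \<le> length u" using s by auto
        show ?thesis
        proof (cases "i = length u")
          case True
          then show ?thesis using qi \<open>y \<in> A\<close>
            by (auto simp: step_def padded_alphabet_def intro!: Q(4) image_eqI[of _ _ "length u"])
        next
          case False
          then have "drop i u = u ! i # drop (Suc i) u" "u ! i \<in> A"
            using qi True by (auto simp: Cons_nth_drop_Suc)
          then show ?thesis using qi \<open>y \<in> A\<close> False
            by (auto simp: step_def padded_alphabet_def intro!: Q(4))
        qed
      qed
      show "v \<in> {v. (u, v) \<in> R} \<longleftrightarrow> v \<in> lists A \<and> finish (foldl step (q0, u) v) \<in> F" for v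
      proof -
        have "(u, v) \<in> R \<longleftrightarrow> pad2 (u, v) \<in> pad2 ` R" by (simp add: inj_image_mem_iff[OF inj_pad2])
        then show ?thesis using R alphabet[of v] by (auto simp: Q(5) run simp del: in_lists_conv_set)
      qed
    qed (use Q \<open>finite A\<close> in \<open>auto intro!: image_eqI[of _ _ 0]\<close>)
  qed
qed

text \<open>Projecting the letters is a letter-to-letter map, after which only the trailing padding has to
  be removed: a state becomes accepting when some amount of padding leads from it to acceptance.\<close>

lemma sync_regular3_projection:
  assumes "sync_regular3 S R" "S \<noteq> {}"
  shows "regular_language S (fst ` R)"
proof -
  let ?P = "padded_alphabet S"
  let ?\<Sigma> = "?P \<times> ?P \<times> ?P - {(None, None, None)}"
  have R: "R \<subseteq> lists S \<times> lists S \<times> lists S" and reg: "regular_language ?\<Sigma> (pad3 ` R)"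
    using assms by (auto simp: sync_regular3_def)
  obtain a where "a \<in> S" using \<open>S \<noteq> {}\<close> by blast
  have "fst ` ?\<Sigma> = ?P"
  proof
    show "?P \<subseteq> fst ` ?\<Sigma>"
    proof
      fix x assume "x \<in> ?P"
      with \<open>a \<in> S\<close> have "(x, Some a, None) \<in> ?\<Sigma>" by (auto simp: padded_alphabet_def)
      then show "x \<in> fst ` ?\<Sigma>" by force
    qed
  qed auto
  with regular_language_map_image[OF reg, of fst]
  have "regular_language ?P (map fst ` pad3 ` R)" by simp
  then obtain Q :: "nat set" and q0 \<delta> F where Q: "finite ?P" "finite Q" "q0 \<in> Q"
    "\<And>q x. q \<in> Q \<Longrightarrow> x \<in> ?P \<Longrightarrow> \<delta> q x \<in> Q"
    "\<And>w. w \<in> map fst ` pad3 ` R \<longleftrightarrow> w \<in> lists ?P \<and> foldl \<delta> q0 w \<in> F"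
    by (rule regular_languageE) (rule that)
  have fin: "finite S"
    using Q(1) by (auto simp: padded_alphabet_def dest: finite_imageD)
  have padded: "(\<exists>i. map Some u @ replicate i None \<in> map fst ` pad3 ` R) \<longleftrightarrow> u \<in> fst ` R" for u
  proof
    assume "\<exists>i. map Some u @ replicate i None \<in> map fst ` pad3 ` R"
    then obtain i x v w where "(x, v, w) \<in> R" "map Some u @ replicate i None = map fst (pad3 (x, v, w))"
      by auto
    then show "u \<in> fst ` R" using map_fst_pad3[of x v w] padding_cancel by (metis fst_conv imageI)
  next
    assume "u \<in> fst ` R"
    then obtain v w where "(u, v, w) \<in> R" by auto
    then show "\<exists>i. map Some u @ replicate i None \<in> map fst ` pad3 ` R"
      using map_fst_pad3[of u v w] by (metis imageI)
  qed
  have run: "foldl (\<lambda>q x. \<delta> q (Some x)) q u = foldl \<delta> q (map Some u)" for q u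
    by (induction u arbitrary: q) auto
  show ?thesis
  proof (rule regular_languageI[where Q = Q and s = q0 and \<delta> = "\<lambda>q x. \<delta> q (Some x)"
        and P = "\<lambda>q. \<exists>i. foldl \<delta> q (replicate i None) \<in> F"])
    show "u \<in> fst ` R \<longleftrightarrow>
      u \<in> lists S \<and> (\<exists>i. foldl \<delta> (foldl (\<lambda>q x. \<delta> q (Some x)) q0 u) (replicate i None) \<in> F)" for u
    proof -
      have "map Some u @ replicate i None \<in> lists ?P" if "u \<in> lists S" for i
        using that by (auto simp: padded_alphabet_def)
      then have "(\<exists>i. foldl \<delta> q0 (map Some u @ replicate i None) \<in> F) \<longleftrightarrow> u \<in> fst ` R"
        if "u \<in> lists S"
        using that padded[of u] unfolding Q(5) by simp
      moreover have "u \<in> lists S" if "u \<in> fst ` R" using that R by auto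
      ultimately show ?thesis unfolding run foldl_append by blast
    qed
  qed (use Q fin in \<open>auto simp: padded_alphabet_def\<close>)
qed


section \<open>EpiRegular groups\<close>

lemma word_value_Nil [simp]: "word_value G [] = \<one>\<^bsub>G\<^esub>"
  and word_value_Cons [simp]: "word_value G (x # w) = x \<otimes>\<^bsub>G\<^esub> word_value G w"
  by (simp_all add: word_value_def)

lemma word_value_closed:
  assumes "group G" "w \<in> lists (carrier G)"
  shows "word_value G w \<in> carrier G"
proof -
  interpret group G by fact
  show ?thesis using assms(2) by (induction w) auto
qed

text \<open>The letters may come from an abstract alphabet, several of them possibly naming the same element.
  Their values generate the group because every element except the identity, the value of the empty
  word, is represented in the language.\<close>

lemma epiRegular_by_labels:
  assumes G: "group G" and p: "p ` A \<subseteq> carrier G" and L: "regular_language A L"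
    and nontrivial: "\<And>w. w \<in> L \<Longrightarrow> word_value G (map p w) \<noteq> \<one>\<^bsub>G\<^esub>"
    and onto: "\<And>h. h \<in> carrier G \<Longrightarrow> h \<noteq> \<one>\<^bsub>G\<^esub> \<Longrightarrow> \<exists>w\<in>L. word_value G (map p w) = h"
  shows "epiRegular G"
proof -
  have sub: "map p w \<in> lists (p ` A)" if "w \<in> L" for w
  proof -
    have "w \<in> lists A" using that regular_language_subset[OF L] by blast
    then show ?thesis by auto
  qed
  have "h \<in> word_value G ` lists (p ` A)" if "h \<in> carrier G" for h
  proof (cases "h = \<one>\<^bsub>G\<^esub>")
    case True
    then show ?thesis by (intro image_eqI[of _ _ "[]"]) auto
  next
    case False
    then show ?thesis using onto[OF that] sub by blast
  qed
  moreover have "word_value G w \<in> carrier G" if "w \<in> lists (p ` A)" for w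
    using that p lists_mono by (intro word_value_closed[OF G]) blast
  ultimately have "generates_as_monoid G (p ` A)"
    using p by (auto simp: generates_as_monoid_def simp del: in_lists_conv_set)
  moreover have "finite (p ` A)" using L by (simp add: regular_language_def)
  ultimately show ?thesis
    unfolding epiRegular_def using G regular_language_map_image[OF L, of p] nontrivial onto
    by (intro conjI exI[of _ "p ` A"] exI[of _ "map p ` L"]) auto
qed

lemma epiRegular_iso:
  assumes "group G" "G \<cong> H" "epiRegular H"
  shows "epiRegular G"
proof -
  have H: "group H" using assms by (simp add: epiRegular_def)
  interpret G: group G by fact
  interpret H: group H by fact
  obtain f where f: "f \<in> iso H G" using G.iso_sym[OF assms(2)] by (auto simp: is_iso_def)
  then have hom: "f \<in> hom H G" and bij: "bij_betw f (carrier H) (carrier G)"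
    by (auto simp: iso_def)
  have one: "f \<one>\<^bsub>H\<^esub> = \<one>\<^bsub>G\<^esub>" using hom_one[OF hom H] assms(1) by blast
  obtain X L where X: "X \<subseteq> carrier H" and L: "regular_language X L"
    and nontrivial: "\<forall>w\<in>L. word_value H w \<noteq> \<one>\<^bsub>H\<^esub>"
    and onto: "\<forall>h\<in>carrier H - {\<one>\<^bsub>H\<^esub>}. \<exists>w\<in>L. word_value H w = h"
    using assms(3) by (auto simp: epiRegular_def generates_as_monoid_def)
  have val: "word_value G (map f w) = f (word_value H w)" if "w \<in> lists (carrier H)" for w
    using that
  proof (induction w)
    case (Cons x w)
    then show ?case using word_value_closed[OF H] by (simp add: hom_mult[OF hom])
  qed (simp add: one)
  have sub: "L \<subseteq> lists (carrier H)"
    using regular_language_subset[OF L] X lists_mono by blast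
  show ?thesis
  proof (rule epiRegular_by_labels[OF assms(1) _ L])
    show "f ` X \<subseteq> carrier G" using X bij by (auto simp: bij_betw_def)
    show "word_value G (map f w) \<noteq> \<one>\<^bsub>G\<^esub>" if "w \<in> L" for w
    proof
      assume "word_value G (map f w) = \<one>\<^bsub>G\<^esub>"
      moreover have "w \<in> lists (carrier H)" using that sub by blast
      ultimately have "f (word_value H w) = f \<one>\<^bsub>H\<^esub>" using val one by simp
      moreover have "word_value H w \<in> carrier H" using that sub word_value_closed[OF H] by blast
      ultimately show False using bij nontrivial that by (auto simp: bij_betw_def inj_on_def)
    qed
    show "\<exists>w\<in>L. word_value G (map f w) = h" if "h \<in> carrier G" "h \<noteq> \<one>\<^bsub>G\<^esub>" for h
    proof -
      have "h \<in> f ` carrier H" using that(1) bij_betw_imp_surj_on[OF bij] by simp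
      then obtain h' where h': "h = f h'" "h' \<in> carrier H" by (rule imageE)
      with that one have "h' \<noteq> \<one>\<^bsub>H\<^esub>" by auto
      with h' onto obtain w where "w \<in> L" "word_value H w = h'" by blast
      then show ?thesis using h' sub val by blast
    qed
  qed
qed


section \<open>Automatic groups and autostackable groups\<close>

text \<open>The words of the word acceptor that represent the identity are those related by the equality
  recogniser to one fixed representative of the identity, so they can be removed.\<close>

lemma automatic_imp_epiRegular:
  assumes "automatic_group G"
  shows "epiRegular G"
proof -
  have G: "group G" using assms by (simp add: automatic_group_def)
  interpret group G by fact
  obtain A :: "nat set" and p L where gen: "generates_as_monoid G (p ` A)"
    and L: "regular_language A L"
    and onto: "\<forall>g \<in> carrier G. \<exists>w\<in>L. word_value G (map p w) = g"
    and eq: "sync_regular2 A {(u, v). u \<in> L \<and> v \<in> L \<and>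
          word_value G (map p u) = word_value G (map p v)}"
    using assms unfolding automatic_group_def by (elim conjE exE) (rule that)
  obtain u where u: "u \<in> L" "word_value G (map p u) = \<one>\<^bsub>G\<^esub>" using onto by blast
  let ?K = "{v. v \<in> L \<and> word_value G (map p v) = \<one>\<^bsub>G\<^esub>}"
  have "regular_language A ?K"
    using sync_regular2_section[OF eq, of u] u by (simp add: eq_commute)
  then have "regular_language A (L - ?K)" by (rule regular_language_diff[OF L])
  then show ?thesis
    by (rule epiRegular_by_labels[OF G, rotated])
      (use gen onto in \<open>auto simp: generates_as_monoid_def\<close>)
qed

text \<open>The empty word is the only normal form of the identity, and the normal forms are the first
  components of the graph of the stacking map.\<close>

lemma autostackable_imp_epiRegular:
  assumes "autostackable G"
  shows "epiRegular G"
proof -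
  have G: "group G" using assms by (simp add: autostackable_def)
  interpret group G by fact
  obtain X N \<phi> where X: "finite X" "X \<subseteq> carrier G" and N: "normal_forms G X N" "[] \<in> N"
    and sync: "sync_regular3 X {(nf G N g, [x], \<phi> (nf G N g) x) | g x. g \<in> carrier G \<and> x \<in> X}"
    using assms unfolding autostackable_def by (elim conjE exE) (rule that)
  have sub: "N \<subseteq> lists X" and uniq: "\<And>g. g \<in> carrier G \<Longrightarrow> \<exists>!y. y \<in> N \<and> word_value G y = g"
    using N by (auto simp: normal_forms_def)
  have closed: "word_value G y \<in> carrier G" if "y \<in> N" for y
    using that sub X lists_mono by (intro word_value_closed[OF G]) blast
  have nf: "nf G N g \<in> N" if "g \<in> carrier G" for g
    unfolding nf_def using theI'[OF uniq[OF that]] by blast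
  have nf_value: "nf G N (word_value G y) = y" if "y \<in> N" for y
    unfolding nf_def using uniq[OF closed[OF that]] that by (intro the1_equality) auto
  have "regular_language X (N - {[]})"
  proof (cases "X = {}")
    (* Without generators the graph of the stacking map is empty and does not determine N. *)
    case True
    with sub have "N - {[]} = {}" by auto
    then show ?thesis using regular_language_empty[OF X(1)] by (simp only:)
  next
    case False
    let ?R = "{(nf G N g, [x], \<phi> (nf G N g) x) | g x. g \<in> carrier G \<and> x \<in> X}"
    have "fst ` ?R = N"
    proof
      show "fst ` ?R \<subseteq> N" using nf by auto
      show "N \<subseteq> fst ` ?R"
      proof
        fix y assume "y \<in> N"
        obtain x where "x \<in> X" using False by blast
        with \<open>y \<in> N\<close> have "(y, [x], \<phi> y x) \<in> ?R" using nf_value closed by force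
        then show "y \<in> fst ` ?R" by force
      qed
    qed
    with sync_regular3_projection[OF sync False] have "regular_language X N" by simp
    then show ?thesis by (rule regular_language_remove_Nil)
  qed
  then show ?thesis
  proof (rule epiRegular_by_labels[OF G, where p = "\<lambda>x. x", rotated])
    show "word_value G (map (\<lambda>x. x) w) \<noteq> \<one>\<^bsub>G\<^esub>" if "w \<in> N - {[]}" for w
      using that uniq[OF one_closed] N(2) by auto
    show "\<exists>w\<in>N - {[]}. word_value G (map (\<lambda>x. x) w) = h" if "h \<in> carrier G" "h \<noteq> \<one>\<^bsub>G\<^esub>" for h
      using that uniq[of h] by auto
  qed (use X in simp)
qed


section \<open>Baumslag-Solitar groups\<close>

text \<open>The normal forms of the HNN extension of the infinite cyclic group: \<open>Syllable i e x\<close> stands for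
  \<open>a\<^sup>i t\<^sup>e x\<close>, where \<open>e\<close> is the sign of the exponent of \<open>t\<close>, and \<open>Tail j\<close> for \<open>a\<^sup>j\<close>.\<close>

datatype nform = Tail int | Syllable int bool nform

fun nform_word :: "nform \<Rightarrow> bs_gen gword" where
  "nform_word (Tail j) = gen_power BS_a j"
| "nform_word (Syllable i e x) = gen_power BS_a i @ (BS_t, e) # nform_word x"

text \<open>If \<open>y\<close> is the conjugate of \<open>x\<close> by \<open>z\<close>, the same holds for their powers.\<close>

lemma (in group) int_pow_commutes_across:
  fixes q :: int
  assumes "x \<in> carrier G" "y \<in> carrier G" "z \<in> carrier G" "x \<otimes> z = z \<otimes> y"
  shows "x [^] q \<otimes> z = z \<otimes> y [^] q"
proof -
  have pow: "x' [^] k \<otimes> z = z \<otimes> y' [^] k"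
    if "x' \<in> carrier G" "y' \<in> carrier G" "x' \<otimes> z = z \<otimes> y'" for x' y' and k :: nat
  proof (induction k)
    case (Suc k)
    have "x' [^] Suc k \<otimes> z = x' [^] k \<otimes> (z \<otimes> y')"
      using that assms(3) by (simp add: m_assoc)
    also have "\<dots> = x' [^] k \<otimes> z \<otimes> y'" using that assms(3) by (simp add: m_assoc)
    also have "\<dots> = z \<otimes> y' [^] Suc k" using that assms(3) by (simp add: Suc m_assoc)
    finally show ?case .
  qed (use assms(3) in simp)
  have "inv x \<otimes> z = inv x \<otimes> (z \<otimes> y) \<otimes> inv y" using assms(1-3) by (simp add: m_assoc)
  also have "\<dots> = z \<otimes> inv y"
    unfolding assms(4)[symmetric] using assms(1-3) by (simp add: m_assoc[symmetric])
  finally have "inv x [^] k \<otimes> z = z \<otimes> inv y [^] k" for k :: nat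
    by (intro pow) (use assms(1,2) in simp_all)
  then have "inv (x [^] k) \<otimes> z = z \<otimes> inv (y [^] k)" for k :: nat
    using assms(1,2) by (simp add: nat_pow_inv)
  moreover have "x [^] k \<otimes> z = z \<otimes> y [^] k" for k :: nat
    using assms by (intro pow)
  ultimately show ?thesis
    by (cases "q < 0") (simp_all only: int_pow_def2 if_True if_False)
qed

text \<open>The defining relation and its inverse form say that \<open>a\<close> to the power \<open>idx e\<close> can be moved to the
  right across \<open>t\<^sup>e\<close>, where it becomes \<open>a\<close> to the power \<open>idx (\<not> e)\<close>.  Treating both signs of \<open>t\<close> by one
  function makes all arguments below symmetric in the two exponents.\<close>

locale bs_indices =
  fixes idx :: "bool \<Rightarrow> int"
  assumes idx_nonzero: "idx e \<noteq> 0"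
begin

subsection \<open>The action on normal forms\<close>

text \<open>Left multiplication by \<open>a\<^sup>k\<close> on normal forms: the exponent in front of \<open>t\<^sup>e\<close> is reduced modulo
  \<open>idx e\<close>, and the quotient is carried across \<open>t\<^sup>e\<close> into the rest.\<close>

fun shift :: "int \<Rightarrow> nform \<Rightarrow> nform" where
  "shift k (Tail j) = Tail (k + j)"
| "shift k (Syllable i e x) =
     Syllable ((k + i) mod idx e) e (shift ((k + i) div idx e * idx (\<not> e)) x)"

text \<open>Left multiplication by \<open>t\<^sup>e\<close>, which is the stable letter of the HNN extension or its inverse.\<close>

fun stable :: "bool \<Rightarrow> nform \<Rightarrow> nform" where
  "stable e (Tail j) = Syllable 0 e (Tail j)"
| "stable e (Syllable i e' x) =
     (if i = 0 \<and> e' = (\<not> e) then x else Syllable 0 e (Syllable i e' x))"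

text \<open>Powers of \<open>a\<close> in front of \<open>t\<^sup>e\<close> are remainders modulo \<open>idx e\<close>, and no cancelling pair
  \<open>t\<^sup>e t\<^sup>-\<^sup>e\<close> occurs; the option argument is the sign of the letter \<open>t\<close> that precedes the normal form.\<close>

fun reduced :: "bool option \<Rightarrow> nform \<Rightarrow> bool" where
  "reduced p (Tail j) \<longleftrightarrow> True"
| "reduced p (Syllable i e x) \<longleftrightarrow>
     i mod idx e = i \<and> \<not> (i = 0 \<and> p = Some (\<not> e)) \<and> reduced (Some e) x"

lemma div_eq_0_of_mod_eq: "i mod idx e = i \<Longrightarrow> i div idx e = 0"
  using mult_div_mod_eq[of "idx e" i] idx_nonzero[of e] by simp

lemma reduced_None: "reduced p x \<Longrightarrow> reduced None x"
  by (cases x) auto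

lemma shift_0: "reduced p x \<Longrightarrow> shift 0 x = x"
  by (induction x arbitrary: p) (auto simp: div_eq_0_of_mod_eq)

lemma shift_shift: "shift k (shift l x) = shift (k + l) x"
proof (induction x arbitrary: k l)
  case (Tail j)
  show ?case by simp
next
  case (Syllable i e x)
  let ?c = "idx e" and ?q = "(l + i) div idx e" and ?r = "(l + i) mod idx e"
  have split: "k + l + i = (k + ?r) + ?c * ?q" by simp
  have "(k + l + i) div ?c = (k + ?r) div ?c + ?q" "(k + l + i) mod ?c = (k + ?r) mod ?c"
    by (subst split, simp only: div_mult_self2[OF idx_nonzero] mod_mult_self2 add.commute)+
  then show ?case by (simp add: Syllable.IH algebra_simps)
qed

text \<open>Carrying a multiple of \<open>idx (\<not> e)\<close> across \<open>t\<^sup>e\<close> cannot create a cancelling pair, because it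
  leaves the remainder in front of a following \<open>t\<^sup>-\<^sup>e\<close> unchanged.\<close>

lemma reduced_shift:
  "reduced p x \<Longrightarrow> (\<And>e. p = Some e \<Longrightarrow> idx (\<not> e) dvd k) \<Longrightarrow> reduced p (shift k x)"
proof (induction x arbitrary: p k)
  case (Tail j)
  show ?case by simp
next
  case (Syllable i e x)
  have "reduced (Some e) (shift ((k + i) div idx e * idx (\<not> e)) x)"
    using Syllable.prems(1) by (intro Syllable.IH) auto
  moreover have "i \<noteq> 0 \<and> (k + i) mod idx e = i" if p: "p = Some (\<not> e)"
  proof -
    have "idx e dvd k" using Syllable.prems(2)[OF p] by simp
    then have "(k + i) mod idx e = i mod idx e" by (auto simp: dvd_def)
    then show ?thesis using Syllable.prems(1) p by auto
  qed
  ultimately show ?case by auto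
qed

lemma reduced_stable: "reduced None x \<Longrightarrow> reduced None (stable e x)"
  by (cases x; cases e) (auto intro: reduced_None[of "Some e" for e])

lemma stable_of_reduced: "reduced (Some e) x \<Longrightarrow> stable e x = Syllable 0 e x"
  by (cases x; cases e) auto

text \<open>This is where reducedness is essential: if \<open>t\<^sup>-\<^sup>e\<close> cancels the first letter of \<open>x\<close>, then the
  subsequent \<open>t\<^sup>e\<close> must not cancel against what follows.\<close>

lemma stable_stable: "reduced None x \<Longrightarrow> stable e (stable (\<not> e) x) = x"
  by (cases x; cases e) (auto simp: stable_of_reduced)

text \<open>The defining relation holds for the action.  If \<open>t\<^sup>e\<close> does not cancel, the quotient carried across
  it is exactly 1.  If \<open>x\<close> starts with \<open>t\<^sup>-\<^sup>e\<close>, then \<open>t\<^sup>e\<close> cancels on both sides, and on the right the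
  quotient 1 has been carried across \<open>t\<^sup>-\<^sup>e\<close> beforehand.\<close>

lemma shift_idx_stable:
  assumes "reduced None x"
  shows "shift (idx e) (stable e x) = stable e (shift (idx (\<not> e)) x)"
proof (cases x)
  case (Tail j)
  then show ?thesis using idx_nonzero by simp
next
  case (Syllable i e' y)
  then show ?thesis using assms idx_nonzero by (cases "e' = e") (auto simp: div_eq_0_of_mod_eq)
qed

fun act :: "bs_gen \<times> bool \<Rightarrow> nform \<Rightarrow> nform" where
  "act (BS_a, b) x = shift (if b then 1 else -1) x"
| "act (BS_t, b) x = stable b x"

lemma reduced_act: "reduced None x \<Longrightarrow> reduced None (act l x)"
  by (cases "(l, x)" rule: act.cases) (auto simp: reduced_stable intro!: reduced_shift)

lemma reduced_act_word: "reduced None x \<Longrightarrow> reduced None (foldr act w x)"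
  by (induction w) (auto simp: reduced_act)

lemma act_gen_power:
  assumes "reduced p x"
  shows "foldr act (gen_power BS_a k) x = shift k x"
proof -
  have "foldr act (replicate n (BS_a, b)) x = shift (if b then int n else - int n) x" for n b
    by (induction n) (auto simp: shift_0[OF assms] shift_shift)
  then show ?thesis by (simp add: gen_power_def)
qed

definition relators :: "(bs_gen gword \<times> bs_gen gword) set" where
  "relators = {(gen_power BS_t (-1) @ gen_power BS_a (idx True) @ gen_power BS_t 1,
     gen_power BS_a (idx False))}"

text \<open>The letters thus define an action of the Baumslag-Solitar group on the reduced normal forms.\<close>

lemma act_pres_eq:
  "pres_eq relators u v \<Longrightarrow> reduced None x \<Longrightarrow> foldr act u x = foldr act v x"
proof (induction arbitrary: x rule: pres_eq.induct)
  case (rel u v)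
  have "stable False (shift (idx True) (stable True x)) = shift (idx False) x"
    using shift_idx_stable[OF rel(2), of True] stable_stable[of "shift (idx False) x" False]
      reduced_shift[OF rel(2)] by simp
  moreover have "gen_power BS_t (-1) = [(BS_t, False)]" "gen_power BS_t 1 = [(BS_t, True)]"
    by (simp_all add: gen_power_def)
  ultimately show ?case using rel
    by (simp add: relators_def act_gen_power[OF reduced_stable] act_gen_power)
next
  case (cancel l b)
  then show ?case
    by (cases l; cases b) (auto simp: shift_shift shift_0 stable_stable[of x False, simplified]
        stable_stable[of x True, simplified])
next
  case (append u u' v v')
  then show ?case using reduced_act_word by simp
qed simp_all

text \<open>A normal form can be recovered from the group element that its word represents, by letting
  that element act on the empty normal form.\<close>

lemma act_nform_word: "reduced p x \<Longrightarrow> foldr act (nform_word x) (Tail 0) = x"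
proof (induction x arbitrary: p)
  case (Tail j)
  show ?case by (simp add: act_gen_power[of None])
next
  case (Syllable i e x)
  then have "foldr act (nform_word (Syllable i e x)) (Tail 0)
      = foldr act (gen_power BS_a i) (Syllable 0 e x)"
    by (simp add: Syllable.IH[of "Some e"] stable_of_reduced)
  also have "\<dots> = Syllable i e x"
    using Syllable.prems
    by (auto simp: act_gen_power[of None] div_eq_0_of_mod_eq intro: shift_0)
  finally show ?case .
qed

lemma nform_word_nontrivial:
  assumes "reduced None x" "nform_word x \<noteq> []"
  shows "\<not> pres_eq relators (nform_word x) []"
proof
  assume "pres_eq relators (nform_word x) []"
  then have "x = Tail 0" using act_pres_eq[of _ _ "Tail 0"] act_nform_word[OF assms(1)] by fastforce
  with assms(2) show False by (simp add: gen_power_def)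
qed


subsection \<open>An automaton for the normal forms\<close>

text \<open>The automaton tracks the sign of the last letter \<open>t\<close> and the exponent of the current power of \<open>a\<close>.
  The exponent is needed exactly only while it can be a remainder, so it is cut off at a bound that
  exceeds all remainders.\<close>

definition bound :: int where "bound = \<bar>idx True\<bar> + \<bar>idx False\<bar>"

definition clip :: "int \<Rightarrow> int" where "clip r = max (- bound) (min bound r)"

fun step :: "(bool option \<times> int) option \<Rightarrow> bs_gen \<times> bool \<Rightarrow> (bool option \<times> int) option" where
  "step None l = None"
| "step (Some (p, r)) (BS_a, b) = (if b \<and> 0 \<le> r then Some (p, clip (r + 1))
     else if \<not> b \<and> r \<le> 0 then Some (p, clip (r - 1)) else None)"
| "step (Some (p, r)) (BS_t, e) =
     (if r mod idx e = r \<and> \<not> (r = 0 \<and> p = Some (\<not> e)) then Some (Some e, 0) else None)"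

lemma bound_gt: "\<bar>idx e\<bar> < bound"
  using idx_nonzero[of True] idx_nonzero[of False] by (cases e) (auto simp: bound_def)

lemma bound_pos: "0 < bound"
  using bound_gt[of True] by linarith

lemma clip_sign: "0 \<le> clip r \<longleftrightarrow> 0 \<le> r" "clip r \<le> 0 \<longleftrightarrow> r \<le> 0" "clip r = 0 \<longleftrightarrow> r = 0"
  using bound_pos by (auto simp: clip_def)

lemma clip_0 [simp]: "clip 0 = 0"
  by (simp add: clip_sign)

lemma clip_succ: "0 \<le> r \<Longrightarrow> clip (clip r + 1) = clip (r + 1)"
  and clip_pred: "r \<le> 0 \<Longrightarrow> clip (clip r - 1) = clip (r - 1)"
  using bound_pos by (auto simp: clip_def)

lemma clip_remainder: "clip r mod idx e = clip r \<longleftrightarrow> r mod idx e = r"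
proof (cases "\<bar>r\<bar> < bound")
  case True
  then show ?thesis by (auto simp: clip_def)
next
  case False
  then have "\<bar>clip r\<bar> \<ge> bound" using bound_pos by (auto simp: clip_def)
  moreover have "\<bar>s mod idx e\<bar> < bound" for s
    using abs_mod_less[OF idx_nonzero, of s e] bound_gt[of e] by linarith
  ultimately show ?thesis using False by (metis not_less)
qed

lemma foldl_step_None: "foldl step None w = None"
  by (induction w) auto

lemma step_gen_power: "foldl step (Some (p, 0)) (gen_power BS_a k) = Some (p, clip k)"
proof -
  have "foldl step (Some (p, 0)) (replicate n (BS_a, b))
      = Some (p, clip (if b then int n else - int n))" for n b
  proof (induction n)
    case 0
    show ?case using bound_pos by (simp add: clip_def)
  next
    case (Suc n)
    have "replicate (Suc n) (BS_a, b) = replicate n (BS_a, b) @ [(BS_a, b)]"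
      by (simp add: replicate_append_same)
    moreover have "clip (int (Suc n)) = clip (int n + 1)" "clip (- int (Suc n)) = clip (- int n - 1)"
      by (rule arg_cong, simp)+
    ultimately show ?case
      by (simp add: Suc clip_sign clip_succ clip_pred del: replicate_Suc of_nat_Suc)
  qed
  then show ?thesis by (simp add: gen_power_def)
qed

lemma gen_power_succ: "0 \<le> r \<Longrightarrow> gen_power x (r + 1) = gen_power x r @ [(x, True)]"
  by (simp add: gen_power_def nat_add_distrib replicate_append_same)

lemma gen_power_pred: "r \<le> 0 \<Longrightarrow> gen_power x (r - 1) = gen_power x r @ [(x, False)]"
proof -
  assume "r \<le> 0"
  then have "nat \<bar>r - 1\<bar> = Suc (nat \<bar>r\<bar>)" by simp
  then show ?thesis using \<open>r \<le> 0\<close> by (cases "r = 0") (simp_all add: gen_power_def replicate_append_same)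
qed

text \<open>To make an induction over the remaining input \<open>w\<close> possible, an arbitrary state is allowed as the
  start; its second component stands for the power \<open>a\<^sup>r\<close> read since the last letter \<open>t\<close>.\<close>

lemma accepted_imp_nform_word:
  "foldl step (Some (p, clip r)) w \<noteq> None \<Longrightarrow> \<exists>x. reduced p x \<and> gen_power BS_a r @ w = nform_word x"
proof (induction w arbitrary: p r)
  case Nil
  show ?case by (intro exI[of _ "Tail r"]) simp
next
  case (Cons l w)
  obtain g b where l: "l = (g, b)" by fastforce
  show ?case
  proof (cases g)
    case BS_t
    with Cons.prems have r: "r mod idx b = r" "\<not> (r = 0 \<and> p = Some (\<not> b))"
      and run: "foldl step (Some (Some b, clip 0)) w \<noteq> None"
      by (auto simp: l clip_remainder clip_sign(3) foldl_step_None split: if_splits)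
    obtain x where "reduced (Some b) x" "w = nform_word x"
      using Cons.IH[OF run] by (auto simp: gen_power_def)
    then show ?thesis using r BS_t l by (intro exI[of _ "Syllable r b x"]) simp
  next
    case BS_a
    show ?thesis
    proof (cases b)
      case True
      with Cons.prems BS_a have "0 \<le> r" "foldl step (Some (p, clip (r + 1))) w \<noteq> None"
        by (auto simp: l clip_sign clip_succ foldl_step_None split: if_splits)
      then show ?thesis using Cons.IH[of p "r + 1"] True BS_a l by (simp add: gen_power_succ)
    next
      case False
      with Cons.prems BS_a have "r \<le> 0" "foldl step (Some (p, clip (r - 1))) w \<noteq> None"
        by (auto simp: l clip_sign clip_pred foldl_step_None split: if_splits)
      then show ?thesis using Cons.IH[of p "r - 1"] False BS_a l by (simp add: gen_power_pred)
    qed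
  qed
qed

lemma nform_word_accepted: "reduced p x \<Longrightarrow> foldl step (Some (p, 0)) (nform_word x) \<noteq> None"
  by (induction x arbitrary: p) (auto simp: step_gen_power clip_remainder clip_sign)

lemma regular_nform_words: "regular_language UNIV {nform_word x | x. reduced None x}"
proof (rule regular_languageI[where Q = "insert None (Some ` (UNIV \<times> {- bound..bound}))"
      and s = "Some (None, 0)" and \<delta> = step and P = "\<lambda>s. s \<noteq> None"])
  have "(UNIV :: bs_gen set) = {BS_a, BS_t}" using bs_gen.exhaust by blast
  moreover have "finite {BS_a, BS_t}" by simp
  ultimately have "finite (UNIV :: bs_gen set)" by (simp only:)
  then show "finite (UNIV :: (bs_gen \<times> bool) set)" by (simp add: finite_prod)
  show "step q l \<in> insert None (Some ` (UNIV \<times> {- bound..bound}))" for q l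
    using bound_pos by (cases "(q, l)" rule: step.cases) (auto simp: clip_def)
  show "w \<in> {nform_word x | x. reduced None x} \<longleftrightarrow>
      w \<in> lists UNIV \<and> foldl step (Some (None, 0)) w \<noteq> None" for w
    using accepted_imp_nform_word[of None 0 w] nform_word_accepted[of None]
    by (auto simp: gen_power_def)
qed (use bound_pos in auto)


subsection \<open>Every element has a normal form\<close>

abbreviation "BS \<equiv> presented_group relators"

interpretation BS: group BS by (rule group_presented_group)

abbreviation bs_class :: "bs_gen gword \<Rightarrow> bs_gen gword set" where
  "bs_class u \<equiv> pres_rel relators `` {u}"

lemma bs_class_append: "bs_class (u @ v) = bs_class u \<otimes>\<^bsub>BS\<^esub> bs_class v"
  by (simp add: presented_group_mult_class)

lemma bs_class_Cons: "bs_class (l # v) = bs_class [l] \<otimes>\<^bsub>BS\<^esub> bs_class v"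
  using bs_class_append[of "[l]" v] by simp

lemma bs_class_Nil: "bs_class [] = \<one>\<^bsub>BS\<^esub>"
  by (simp add: presented_group_def)

lemma bs_class_closed [simp]: "bs_class u \<in> carrier BS"
  by (auto simp: presented_group_def quotient_def)

lemma bs_class_eq_iff: "bs_class u = bs_class v \<longleftrightarrow> pres_eq relators u v"
  using eq_equiv_class_iff[OF equiv_pres_rel, of u v relators] by (simp add: pres_rel_def)

lemma bs_class_False: "bs_class [(x, False)] = inv\<^bsub>BS\<^esub> bs_class [(x, True)]"
proof (rule BS.inv_equality[symmetric])
  have "bs_class [(x, False), (x, True)] = bs_class []"
    unfolding bs_class_eq_iff using pres_eq.cancel[of relators x False] by simp
  then show "bs_class [(x, False)] \<otimes>\<^bsub>BS\<^esub> bs_class [(x, True)] = \<one>\<^bsub>BS\<^esub>"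
    by (simp add: bs_class_append[symmetric] bs_class_Nil)
qed simp_all

lemma bs_class_gen_power: "bs_class (gen_power x k) = bs_class [(x, True)] [^]\<^bsub>BS\<^esub> k"
proof -
  have pow: "bs_class (replicate n l) = bs_class [l] [^]\<^bsub>BS\<^esub> n" for n l
  proof (induction n)
    case (Suc n)
    have "replicate (Suc n) l = replicate n l @ [l]" by (simp add: replicate_append_same)
    then show ?case by (simp add: bs_class_append Suc del: replicate_Suc)
  qed (simp add: bs_class_Nil)
  show ?thesis
  proof (cases "k < 0")
    case True
    then have "gen_power x k = replicate (nat (- k)) (x, False)" by (simp add: gen_power_def)
    then show ?thesis
      by (simp only: True int_pow_def2 if_True pow bs_class_False BS.nat_pow_inv[OF bs_class_closed])
  next
    case False
    then have "gen_power x k = replicate (nat k) (x, True)" by (simp add: gen_power_def)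
    then show ?thesis by (simp only: False int_pow_def2 if_False pow)
  qed
qed

lemma word_value_bs_class: "word_value BS (map (\<lambda>l. bs_class [l]) w) = bs_class w"
  by (induction w) (simp_all add: bs_class_Nil bs_class_Cons[symmetric])

abbreviation "gen_a \<equiv> bs_class [(BS_a, True)]"

lemma gen_a_across:
  "gen_a [^]\<^bsub>BS\<^esub> (q * idx e) \<otimes>\<^bsub>BS\<^esub> bs_class [(BS_t, e)] =
   bs_class [(BS_t, e)] \<otimes>\<^bsub>BS\<^esub> gen_a [^]\<^bsub>BS\<^esub> (q * idx (\<not> e))"
proof -
  let ?t = "bs_class [(BS_t, True)]" and ?m = "gen_a [^]\<^bsub>BS\<^esub> idx True" and ?n = "gen_a [^]\<^bsub>BS\<^esub> idx False"
  have "bs_class (gen_power BS_t (-1) @ gen_power BS_a (idx True) @ gen_power BS_t 1)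
      = bs_class (gen_power BS_a (idx False))"
    unfolding bs_class_eq_iff by (rule pres_eq.rel) (simp add: relators_def)
  then have rel: "inv\<^bsub>BS\<^esub> ?t \<otimes>\<^bsub>BS\<^esub> (?m \<otimes>\<^bsub>BS\<^esub> ?t) = ?n"
    by (simp add: bs_class_append bs_class_gen_power BS.int_pow_neg)
  have "gen_a [^]\<^bsub>BS\<^esub> idx e \<otimes>\<^bsub>BS\<^esub> bs_class [(BS_t, e)]
      = bs_class [(BS_t, e)] \<otimes>\<^bsub>BS\<^esub> gen_a [^]\<^bsub>BS\<^esub> idx (\<not> e)"
  proof (cases e)
    case True
    then show ?thesis by (simp add: rel[symmetric] BS.m_assoc[symmetric])
  next
    case False
    then show ?thesis by (simp add: rel[symmetric] bs_class_False BS.m_assoc)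
  qed
  from BS.int_pow_commutes_across[OF _ _ _ this, of q] show ?thesis
    by (simp add: BS.int_pow_pow mult.commute)
qed

lemma bs_class_shift: "bs_class (nform_word (shift k x)) = gen_a [^]\<^bsub>BS\<^esub> k \<otimes>\<^bsub>BS\<^esub> bs_class (nform_word x)"
proof (induction x arbitrary: k)
  case (Tail j)
  show ?case by (simp add: bs_class_gen_power BS.int_pow_mult)
next
  case (Syllable i e x)
  let ?q = "(k + i) div idx e" and ?r = "(k + i) mod idx e"
  let ?t = "bs_class [(BS_t, e)]" and ?x = "bs_class (nform_word x)"
  have across: "gen_a [^]\<^bsub>BS\<^esub> (?q * idx e) \<otimes>\<^bsub>BS\<^esub> (?t \<otimes>\<^bsub>BS\<^esub> ?x)
      = ?t \<otimes>\<^bsub>BS\<^esub> (gen_a [^]\<^bsub>BS\<^esub> (?q * idx (\<not> e)) \<otimes>\<^bsub>BS\<^esub> ?x)"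
    using gen_a_across[of ?q e] by (simp add: BS.m_assoc[symmetric])
  have "bs_class (nform_word (shift k (Syllable i e x)))
      = gen_a [^]\<^bsub>BS\<^esub> ?r \<otimes>\<^bsub>BS\<^esub> (?t \<otimes>\<^bsub>BS\<^esub> (gen_a [^]\<^bsub>BS\<^esub> (?q * idx (\<not> e)) \<otimes>\<^bsub>BS\<^esub> ?x))"
    by (simp add: bs_class_append bs_class_Cons[of "(BS_t, e)" "nform_word y" for y] bs_class_gen_power Syllable.IH)
  also have "\<dots> = gen_a [^]\<^bsub>BS\<^esub> ?r \<otimes>\<^bsub>BS\<^esub> gen_a [^]\<^bsub>BS\<^esub> (?q * idx e) \<otimes>\<^bsub>BS\<^esub> (?t \<otimes>\<^bsub>BS\<^esub> ?x)"
    using across by (simp add: BS.m_assoc)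
  also have "gen_a [^]\<^bsub>BS\<^esub> ?r \<otimes>\<^bsub>BS\<^esub> gen_a [^]\<^bsub>BS\<^esub> (?q * idx e) = gen_a [^]\<^bsub>BS\<^esub> (k + i)"
    using BS.int_pow_mult[of gen_a ?r "?q * idx e"] by (simp add: mod_div_mult_eq)
  also have "\<dots> \<otimes>\<^bsub>BS\<^esub> (?t \<otimes>\<^bsub>BS\<^esub> ?x) = gen_a [^]\<^bsub>BS\<^esub> k \<otimes>\<^bsub>BS\<^esub> bs_class (nform_word (Syllable i e x))"
    by (simp add: bs_class_append bs_class_Cons[of "(BS_t, e)" "nform_word y" for y] bs_class_gen_power BS.int_pow_mult BS.m_assoc)
  finally show ?case .
qed

lemma bs_class_stable: "bs_class (nform_word (stable e x)) = bs_class [(BS_t, e)] \<otimes>\<^bsub>BS\<^esub> bs_class (nform_word x)"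
proof -
  have cancel: "bs_class [(BS_t, e)] \<otimes>\<^bsub>BS\<^esub> bs_class [(BS_t, \<not> e)] = \<one>\<^bsub>BS\<^esub>"
    by (cases e) (simp_all add: bs_class_False)
  have zero: "gen_power BS_a 0 = []" by (simp add: gen_power_def)
  show ?thesis
  proof (cases "\<exists>y. x = Syllable 0 (\<not> e) y")
    case True
    then obtain y where "x = Syllable 0 (\<not> e) y" by blast
    then show ?thesis
      by (simp add: zero bs_class_Cons[of "(BS_t, \<not> e)" "nform_word y"] BS.m_assoc[symmetric] cancel)
  next
    case False
    then have "stable e x = Syllable 0 e x" by (cases x) auto
    then show ?thesis by (simp add: zero bs_class_Cons[of "(BS_t, e)" "nform_word y" for y])
  qed
qed

text \<open>The action on normal forms agrees with multiplication in the group, so letting a word act on the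
  empty normal form computes a normal form of the element that the word represents.\<close>

lemma bs_class_act: "bs_class (nform_word (act l x)) = bs_class (l # nform_word x)"
proof -
  obtain g b where "l = (g, b)" by fastforce
  then show ?thesis
    by (cases g; cases b)
      (simp_all add: bs_class_Cons[of _ "nform_word x"] bs_class_shift bs_class_stable bs_class_False BS.int_pow_neg)
qed

lemma bs_class_normal_form: "bs_class (nform_word (foldr act u (Tail 0))) = bs_class u"
proof (induction u)
  case Nil
  show ?case by (simp add: gen_power_def)
next
  case (Cons l u)
  then show ?case by (simp add: bs_class_act bs_class_Cons[of l u]
      bs_class_Cons[of l "nform_word (foldr act u (Tail 0))"])
qed

lemma epiRegular_BS: "epiRegular BS"
proof (rule epiRegular_by_labels[OF BS.group_axioms _ regular_language_remove_Nil[OF regular_nform_words],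
      where p = "\<lambda>l. bs_class [l]"])
  show "word_value BS (map (\<lambda>l. bs_class [l]) w) \<noteq> \<one>\<^bsub>BS\<^esub>"
    if "w \<in> {nform_word x | x. reduced None x} - {[]}" for w
    using that nform_word_nontrivial
    by (auto simp: word_value_bs_class bs_class_Nil[symmetric] bs_class_eq_iff)
  show "\<exists>w\<in>{nform_word x | x. reduced None x} - {[]}. word_value BS (map (\<lambda>l. bs_class [l]) w) = h"
    if "h \<in> carrier BS" "h \<noteq> \<one>\<^bsub>BS\<^esub>" for h
  proof -
    have "h \<in> UNIV // pres_rel relators" using that(1) by (simp add: presented_group_def)
    then obtain u where u: "h = bs_class u" by (rule quotientE)
    let ?x = "foldr act u (Tail 0)"
    have "bs_class (nform_word ?x) = h" using bs_class_normal_form u by simp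
    moreover from this have "nform_word ?x \<noteq> []" using that(2) bs_class_Nil by auto
    moreover have "reduced None ?x" by (simp add: reduced_act_word)
    ultimately show ?thesis by (auto simp: word_value_bs_class)
  qed
qed auto

end

lemma epiRegular_baumslag_solitar:
  assumes "m \<noteq> 0" "n \<noteq> 0"
  shows "epiRegular (baumslag_solitar m n)"
proof -
  interpret bs_indices "\<lambda>e. if e then m else n"
    by unfold_locales (use assms in simp)
  show ?thesis using epiRegular_BS by (simp add: baumslag_solitar_def relators_def)
qed


theorem theoremB:
  fixes G :: "('a, 'b) monoid_scheme"
  assumes "group G"
  shows "(\<forall>m n :: int. m \<noteq> 0 \<and> n \<noteq> 0 \<and> G \<cong> baumslag_solitar m n \<longrightarrow> epiRegular G) \<and>
         (automatic_group G \<longrightarrow> epiRegular G) \<and>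
         (autostackable G \<longrightarrow> epiRegular G)"
  using assms epiRegular_iso epiRegular_baumslag_solitar automatic_imp_epiRegular
    autostackable_imp_epiRegular by blast

end
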